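(* Let $a>0$, let $w\neq0$ be real, let $\alpha$ be real with $0<|\alpha|<1$, and let $f$ and $g$ be suitably smooth functions on $[0,a]$ with $g$ real-valued, $g(0)=0$ and $g'(x)>0$ for $x\in[0,a]$. Let $0=x_0<x_1<\cdots<x_n=a$ be nodes with multiplicities $m_0,\ldots,m_n\ge1$, let $M=\sum_{j=0}^n m_j-1$ and $s=\min(m_0,m_n)-1$. Then the Filon-type method $Q_{w,\alpha,n}^{F,s}[f]$ based on the basis set $\Psi_{M+1}=\{g',g'g,g'g^2,\ldots,g'g^{M}\}$ is identical to the Levin method $Q_{w,\alpha,n}^{L,s}[f]$ using the basis set $\Phi_M=\{1,g,g^2,\ldots,g^{M-1}\}$; that is, $$ Q_{w,\alpha,n}^{F,s}[f]=Q_{w,\alpha,n}^{L,s}[f]. $$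
   Context: "Suitably smooth" means having as many continuous derivatives on $[0,a]$ as needed (it may be read as $C^\infty[0,a]$). The function $f_1$ is $f_1(x)=f(x)\left(\frac{x}{g(x)}\right)^\alpha$ for $x\ne0$ and $f_1(0)=\frac{f(0)}{(g'(0))^\alpha}$. Filon-type method (approximating $\int_0^a f(x)x^\alpha e^{iwg(x)}dx$): let $p\in\operatorname{span}\Psi_{M+1}$ be the solution of $p^{(j)}(x_l)=f_1^{(j)}(x_l)$ for $j=0,\ldots,m_l-1$, $l=0,\ldots,n$, and set $$Q_{w,\alpha,n}^{F,s}[f]=\int_0^a p(x)g^\alpha(x)e^{iwg(x)}\,dx.$$ Levin method: for a number $c_0$ and a function $q_1$ let $$\mathcal{W}[c_0,q_1](x)=iwg'(x)c_0+g(x)q_1'(x)+[1+\alpha+iwg(x)]g'(x)q_1(x).$$ Let $c_0$ and $q_1\in\operatorname{span}\Phi_M$ be the solution of $\frac{d^{j}\mathcal{W}[c_0,q_1]}{dx^j}(x_l)=f_1^{(j)}(x_l)$ for $j=0,\ldots,m_l-1$, $l=0,\ldots,n$. Set $$h(x)=\alpha c_0e^{-iwg(x)}\int_0^x\frac{g'(t)(1-e^{iwg(t)})}{g^{1-\alpha}(t)}\,dt,$$ $$Q_{w,\alpha,n}^{L,s}[f]=\left.\left[g^{\alpha+1}(x)q_1(x)+c_0(1-e^{-iwg(x)})g^\alpha(x)+h(x)\right]e^{iwg(x)}\right|_0^a,$$ where the value at $x=0$ is understood as the limit $x\to0^+$ (which is $0$). *)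

theory Defs
  imports "HOL-Analysis.Analysis" "HOL-Library.Function_Algebras"
begin

text \<open>
  All derivatives are taken within \<open>{0..a}\<close>, hence are one-sided at the end points; only the
  values of a function on \<open>{0..a}\<close> influence its derivatives at points of \<open>{0..a}\<close>.
\<close>

definition D :: "real \<Rightarrow> (real \<Rightarrow> 'a::real_normed_vector) \<Rightarrow> real \<Rightarrow> 'a" where
  "D a u = (\<lambda>x. vector_derivative u (at x within {0..a}))"

abbreviation Dn :: "real \<Rightarrow> nat \<Rightarrow> (real \<Rightarrow> 'a::real_normed_vector) \<Rightarrow> real \<Rightarrow> 'a" where
  "Dn a j u \<equiv> (D a ^^ j) u"

text \<open>
  \<open>C\<^sup>\<infinity>[0,a]\<close>. Continuity of the derivatives need not be required separately, as every derivative
  is itself differentiable.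
\<close>

definition smooth :: "real \<Rightarrow> (real \<Rightarrow> 'a::real_normed_vector) \<Rightarrow> bool" where
  "smooth a u \<longleftrightarrow> (\<forall>j. \<forall>x\<in>{0..a}. Dn a j u differentiable (at x within {0..a}))"

text \<open>Span over \<open>\<complex>\<close>; addition of functions is pointwise (\<^theory>\<open>HOL-Library.Function_Algebras\<close>).\<close>

definition cspan :: "(real \<Rightarrow> complex) set \<Rightarrow> (real \<Rightarrow> complex) set" where
  "cspan = module.span (\<lambda>(c::complex) u x. c * u x)"

lemma vector_space_fun: "vector_space (\<lambda>(c::complex) (u :: real \<Rightarrow> complex) x. c * u x)"
  by unfold_locales (auto simp: fun_eq_iff algebra_simps)

definition Psi :: "real \<Rightarrow> (real \<Rightarrow> real) \<Rightarrow> nat \<Rightarrow> (real \<Rightarrow> complex) set" where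
  "Psi a g N = {(\<lambda>x. complex_of_real (D a g x * g x ^ k)) | k. k < N}"

definition Phi :: "(real \<Rightarrow> real) \<Rightarrow> nat \<Rightarrow> (real \<Rightarrow> complex) set" where
  "Phi g N = {(\<lambda>x. complex_of_real (g x ^ k)) | k. k < N}"

definition f1 :: "real \<Rightarrow> real \<Rightarrow> (real \<Rightarrow> real) \<Rightarrow> (real \<Rightarrow> complex) \<Rightarrow> real \<Rightarrow> complex" where
  "f1 a \<alpha> g f x =
     (if x = 0 then f 0 / complex_of_real (D a g 0 powr \<alpha>)
      else f x * complex_of_real ((x / g x) powr \<alpha>))"

text \<open>Hermite conditions at the nodes \<open>X 0, \<dots>, X n\<close> with multiplicities \<open>m 0, \<dots>, m n\<close>.\<close>

definition interpolates ::
    "real \<Rightarrow> nat \<Rightarrow> (nat \<Rightarrow> real) \<Rightarrow> (nat \<Rightarrow> nat) \<Rightarrow> (real \<Rightarrow> complex) \<Rightarrow> (real \<Rightarrow> complex) \<Rightarrow> bool" where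
  "interpolates a n X m u v \<longleftrightarrow> (\<forall>l\<le>n. \<forall>j<m l. Dn a j u (X l) = Dn a j v (X l))"

definition filon_solution ::
    "real \<Rightarrow> real \<Rightarrow> (real \<Rightarrow> real) \<Rightarrow> nat \<Rightarrow> (nat \<Rightarrow> real) \<Rightarrow> (nat \<Rightarrow> nat)
      \<Rightarrow> (real \<Rightarrow> complex) set \<Rightarrow> (real \<Rightarrow> complex) \<Rightarrow> (real \<Rightarrow> complex) \<Rightarrow> bool" where
  "filon_solution a \<alpha> g n X m \<Psi> f p \<longleftrightarrow> p \<in> cspan \<Psi> \<and> interpolates a n X m p (f1 a \<alpha> g f)"

text \<open>
  For \<open>\<alpha> < 0\<close> the integrand has an integrable singularity at \<open>0\<close>, where
  \<open>0 powr \<alpha> = 0\<close> in HOL; a single point does not affect the integral. The same applies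
  to the integral in \<open>levin_h\<close>.
\<close>

definition Q_filon ::
    "real \<Rightarrow> real \<Rightarrow> real \<Rightarrow> (real \<Rightarrow> real) \<Rightarrow> nat \<Rightarrow> (nat \<Rightarrow> real) \<Rightarrow> (nat \<Rightarrow> nat)
      \<Rightarrow> (real \<Rightarrow> complex) set \<Rightarrow> (real \<Rightarrow> complex) \<Rightarrow> complex" where
  "Q_filon a w \<alpha> g n X m \<Psi> f =
     (let p = (THE p. filon_solution a \<alpha> g n X m \<Psi> f p)
      in integral {0..a} (\<lambda>x. p x * complex_of_real (g x powr \<alpha>) * exp (\<i> * w * g x)))"

definition levin_W ::
    "real \<Rightarrow> real \<Rightarrow> real \<Rightarrow> (real \<Rightarrow> real) \<Rightarrow> complex \<Rightarrow> (real \<Rightarrow> complex) \<Rightarrow> real \<Rightarrow> complex" where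
  "levin_W a w \<alpha> g c\<^sub>0 q\<^sub>1 x =
     \<i> * w * complex_of_real (D a g x) * c\<^sub>0 + g x * D a q\<^sub>1 x + (1 + \<alpha> + \<i> * w * g x) * complex_of_real (D a g x) * q\<^sub>1 x"

definition levin_solution ::
    "real \<Rightarrow> real \<Rightarrow> real \<Rightarrow> (real \<Rightarrow> real) \<Rightarrow> nat \<Rightarrow> (nat \<Rightarrow> real) \<Rightarrow> (nat \<Rightarrow> nat)
      \<Rightarrow> (real \<Rightarrow> complex) set \<Rightarrow> (real \<Rightarrow> complex) \<Rightarrow> complex \<times> (real \<Rightarrow> complex) \<Rightarrow> bool" where
  "levin_solution a w \<alpha> g n X m \<Phi> f = (\<lambda>(c\<^sub>0, q\<^sub>1).
     q\<^sub>1 \<in> cspan \<Phi> \<and> interpolates a n X m (levin_W a w \<alpha> g c\<^sub>0 q\<^sub>1) (f1 a \<alpha> g f))"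

definition levin_h ::
    "real \<Rightarrow> real \<Rightarrow> real \<Rightarrow> (real \<Rightarrow> real) \<Rightarrow> complex \<Rightarrow> real \<Rightarrow> complex" where
  "levin_h a w \<alpha> g c\<^sub>0 x =
     \<alpha> * c\<^sub>0 * exp (- \<i> * w * g x) *
       integral {0..x} (\<lambda>t. complex_of_real (D a g t) * (1 - exp (\<i> * w * g t)) / complex_of_real (g t powr (1 - \<alpha>)))"

definition levin_primitive ::
    "real \<Rightarrow> real \<Rightarrow> real \<Rightarrow> (real \<Rightarrow> real) \<Rightarrow> complex \<Rightarrow> (real \<Rightarrow> complex) \<Rightarrow> real \<Rightarrow> complex" where
  "levin_primitive a w \<alpha> g c\<^sub>0 q\<^sub>1 x =
     (complex_of_real (g x powr (\<alpha> + 1)) * q\<^sub>1 x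
       + c\<^sub>0 * (1 - exp (- \<i> * w * g x)) * complex_of_real (g x powr \<alpha>)
       + levin_h a w \<alpha> g c\<^sub>0 x) * exp (\<i> * w * g x)"

definition Q_levin ::
    "real \<Rightarrow> real \<Rightarrow> real \<Rightarrow> (real \<Rightarrow> real) \<Rightarrow> nat \<Rightarrow> (nat \<Rightarrow> real) \<Rightarrow> (nat \<Rightarrow> nat)
      \<Rightarrow> (real \<Rightarrow> complex) set \<Rightarrow> (real \<Rightarrow> complex) \<Rightarrow> complex" where
  "Q_levin a w \<alpha> g n X m \<Phi> f =
     (let (c\<^sub>0, q\<^sub>1) = (THE cq. levin_solution a w \<alpha> g n X m \<Phi> f cq)
      in levin_primitive a w \<alpha> g c\<^sub>0 q\<^sub>1 a - Lim (at_right 0) (levin_primitive a w \<alpha> g c\<^sub>0 q\<^sub>1))"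

end

theory Submission
  imports Defs
begin

text \<open>
  Put \<open>b = g'\<close>. The span of \<open>\<Psi>\<close> consists of the functions \<open>b \<cdot> P(g)\<close> with \<open>P\<close> a complex polynomial
  of degree at most \<open>M\<close>. On the other side, for \<open>q\<^sub>1 = Q(g)\<close> with \<open>deg Q < M\<close> the chain rule gives
  \<open>\<W>[c\<^sub>0, q\<^sub>1] = b \<cdot> T(g)\<close> with \<open>T(y) = i w c\<^sub>0 + y Q'(y) + (1 + \<alpha> + i w y) Q(y)\<close>, and since \<open>w \<noteq> 0\<close> the
  map \<open>(c\<^sub>0, Q) \<mapsto> T\<close> is a bijection onto the polynomials of degree at most \<open>M\<close>
  (\<open>levin_poly_exists\<close>, \<open>levin_poly_inject\<close>). So both methods pose the same Hermite problem for a
  polynomial in \<open>g\<close>, and \<open>p = \<W>[c\<^sub>0, q\<^sub>1]\<close> as soon as that problem has exactly one solution.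

  Unique solvability (\<open>hermite_ex1\<close>) is the usual counting argument transported along \<open>g\<close>: as \<open>b\<close> and
  \<open>g'\<close> have no zeros and \<open>g\<close> is injective, \<open>b \<cdot> P(g)\<close> vanishes to order \<open>k\<close> at a node \<open>x\<close> exactly when
  \<open>P\<close> vanishes to order \<open>k\<close> at \<open>g x\<close>. A nonzero solution of the homogeneous problem would thus be a polynomial of degree at most
  \<open>M\<close> with at least \<open>M + 1\<close> roots.

  Finally, the Levin expression is an antiderivative of \<open>\<W>[c\<^sub>0, q\<^sub>1] g\<^sup>\<alpha> e\<^sup>i\<^sup>w\<^sup>g\<close>: the auxiliary
  function \<open>h\<close> is made to cancel the term \<open>\<alpha> c\<^sub>0 (e\<^sup>i\<^sup>w\<^sup>g - 1) g\<^sup>\<alpha>\<^sup>-\<^sup>1 g'\<close> which the product rule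
  produces. It is continuous up to \<open>0\<close>, even for negative \<open>\<alpha>\<close>, because \<open>1 - e\<^sup>i\<^sup>w\<^sup>g = O(g)\<close>
  and \<open>1 + \<alpha> > 0\<close>; the fundamental theorem of calculus (\<open>levin_primitive_FTC\<close>) then identifies the
  two quadrature values.
\<close>

section \<open>Calculus of smooth functions on a compact interval\<close>

lemma D_eqI:
  assumes "a > 0" "x \<in> {0..a}" "(u has_vector_derivative u') (at x within {0..a})"
  shows "D a u x = u'"
proof -
  have "at x within {0..a} \<noteq> bot"
    using assms(1,2) by (simp add: trivial_limit_within islimpt_Icc)
  then show ?thesis
    unfolding D_def using assms(3) by (rule vector_derivative_within)
qed

lemma has_D:
  assumes "u differentiable (at x within {0..a})"
  shows "(u has_vector_derivative D a u x) (at x within {0..a})"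
  unfolding D_def using assms vector_derivative_works by blast

lemma D_cong:
  assumes "\<And>x. x \<in> {0..a} \<Longrightarrow> u x = v x" "x \<in> {0..a}"
  shows "D a u x = D a v x"
proof -
  have "(u has_vector_derivative y) (at x within {0..a}) = (v has_vector_derivative y) (at x within {0..a})" for y
    using assms by (metis has_vector_derivative_transform)
  then show ?thesis by (simp add: D_def vector_derivative_def)
qed

lemma Dn_Suc: "Dn a (Suc j) u = Dn a j (D a u)"
  by (simp add: funpow_swap1)

lemma Dn_cong:
  assumes "\<And>x. x \<in> {0..a} \<Longrightarrow> u x = v x" "x \<in> {0..a}"
  shows "Dn a j u x = Dn a j v x"
  using assms
proof (induction j arbitrary: u v)
  case (Suc j)
  show ?case unfolding Dn_Suc
    by (rule Suc.IH) (use Suc.prems D_cong in blast)+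
qed auto

text \<open>
  Smoothness of a product cannot be shown by induction with \<^const>\<open>smooth\<close> alone, since the derivative of
  a product is a sum of products whose smoothness is not yet known. Finite differentiability,
  peeled off from the innermost derivative, gives an induction on the order instead.
\<close>

primrec diff_upto :: "nat \<Rightarrow> real \<Rightarrow> (real \<Rightarrow> 'a::real_normed_vector) \<Rightarrow> bool" where
  "diff_upto 0 a u \<longleftrightarrow> True"
| "diff_upto (Suc j) a u \<longleftrightarrow> (\<forall>x\<in>{0..a}. u differentiable (at x within {0..a})) \<and> diff_upto j a (D a u)"

lemma diff_upto_iff:
  "diff_upto j a u \<longleftrightarrow> (\<forall>i<j. \<forall>x\<in>{0..a}. Dn a i u differentiable (at x within {0..a}))"
proof (induction j arbitrary: u)
  case (Suc j)
  show ?case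
    by (simp add: Suc.IH All_less_Suc2 funpow_swap1)
qed auto

lemma smooth_iff_diff_upto: "smooth a u \<longleftrightarrow> (\<forall>j. diff_upto j a u)"
  unfolding smooth_def diff_upto_iff by blast

lemma smooth_differentiable:
  "smooth a u \<Longrightarrow> x \<in> {0..a} \<Longrightarrow> u differentiable (at x within {0..a})"
  unfolding smooth_def by (metis funpow_0)

lemma smooth_has_D:
  "smooth a u \<Longrightarrow> x \<in> {0..a} \<Longrightarrow> (u has_vector_derivative D a u x) (at x within {0..a})"
  using has_D smooth_differentiable by blast

lemma smooth_D: "smooth a u \<Longrightarrow> smooth a (D a u)"
  unfolding smooth_iff_diff_upto by (metis diff_upto.simps(2))

lemma diff_upto_cong:
  assumes "\<And>x. x \<in> {0..a} \<Longrightarrow> u x = v x" "diff_upto j a u"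
  shows "diff_upto j a v"
  using assms
proof (induction j arbitrary: u v)
  case (Suc j)
  have "v differentiable (at x within {0..a})" if "x \<in> {0..a}" for x
    using Suc.prems that has_D[of u x a] has_vector_derivative_transform[of x "{0..a}" v u]
    by (metis diff_upto.simps(2) differentiableI_vector)
  moreover have "diff_upto j a (D a v)"
    by (rule Suc.IH[of "D a u"]) (use Suc.prems in \<open>auto simp del: atLeastAtMost_iff intro: D_cong\<close>)
  ultimately show ?case by simp
qed auto

lemma diff_upto_Suc_imp: "diff_upto (Suc j) a u \<Longrightarrow> diff_upto j a u"
  by (simp add: diff_upto_iff)

lemma diff_upto_const: "a > 0 \<Longrightarrow> diff_upto j a (\<lambda>x. c)"
proof (induction j arbitrary: c)
  case (Suc j)
  have "diff_upto j a (D a (\<lambda>x. c))"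
    by (rule diff_upto_cong[OF _ Suc.IH[of 0]])
       (use Suc.prems in \<open>auto simp del: atLeastAtMost_iff intro!: D_eqI\<close>)
  then show ?case by simp
qed auto

lemma diff_upto_add:
  assumes "a > 0"
  shows "diff_upto j a u \<Longrightarrow> diff_upto j a v \<Longrightarrow> diff_upto j a (\<lambda>x. u x + v x)"
proof (induction j arbitrary: u v)
  case (Suc j)
  have "diff_upto j a (D a (\<lambda>x. u x + v x))"
    by (rule diff_upto_cong[OF _ Suc.IH[of "D a u" "D a v"]])
       (use Suc.prems assms in \<open>auto intro!: D_eqI[symmetric] has_vector_derivative_add has_D\<close>)
  then show ?case using Suc.prems by simp
qed auto

lemma diff_upto_mult:
  fixes u v :: "real \<Rightarrow> 'a::real_normed_algebra"
  assumes "a > 0"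
  shows "diff_upto j a u \<Longrightarrow> diff_upto j a v \<Longrightarrow> diff_upto j a (\<lambda>x. u x * v x)"
proof (induction j arbitrary: u v)
  case (Suc j)
  have "diff_upto j a (D a (\<lambda>x. u x * v x))"
  proof (rule diff_upto_cong)
    show "diff_upto j a (\<lambda>x. u x * D a v x + D a u x * v x)"
      using Suc.prems diff_upto_Suc_imp[OF Suc.prems(1)] diff_upto_Suc_imp[OF Suc.prems(2)]
      by (intro diff_upto_add Suc.IH assms) simp_all
    show "u x * D a v x + D a u x * v x = D a (\<lambda>x. u x * v x) x" if "x \<in> {0..a}" for x
      using Suc.prems that assms
      by (intro D_eqI[symmetric] has_vector_derivative_mult has_D) auto
  qed
  then show ?case using Suc.prems by (auto intro: differentiable_mult)
qed auto

lemma smooth_const: "a > 0 \<Longrightarrow> smooth a (\<lambda>x. c)"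
  and smooth_add: "a > 0 \<Longrightarrow> smooth a u \<Longrightarrow> smooth a v \<Longrightarrow> smooth a (\<lambda>x. u x + v x)"
  by (simp_all add: smooth_iff_diff_upto diff_upto_const diff_upto_add)

lemma smooth_mult:
  fixes u v :: "real \<Rightarrow> 'a::real_normed_algebra"
  shows "a > 0 \<Longrightarrow> smooth a u \<Longrightarrow> smooth a v \<Longrightarrow> smooth a (\<lambda>x. u x * v x)"
  by (simp add: smooth_iff_diff_upto diff_upto_mult)

lemma smooth_poly:
  fixes u :: "real \<Rightarrow> 'a::real_normed_field"
  assumes "a > 0" "smooth a u"
  shows "smooth a (\<lambda>x. poly P (u x))"
  by (induction P) (auto intro!: smooth_const smooth_add smooth_mult assms)

lemma D_of_real:
  assumes "a > 0" "smooth a u" "x \<in> {0..a}"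
  shows "D a (\<lambda>x. of_real (u x) :: 'a::real_normed_algebra_1) x = of_real (D a u x)"
  using assms smooth_has_D[OF assms(2,3)]
  by (intro D_eqI has_vector_derivative_of_real) (simp_all add: has_real_derivative_iff_has_vector_derivative)

lemma smooth_of_real:
  assumes "a > 0" "smooth a u"
  shows "smooth a (\<lambda>x. of_real (u x) :: 'a::real_normed_algebra_1)"
proof -
  have "diff_upto j a (\<lambda>x. of_real (u x) :: 'a)" for j
    using assms(2)
  proof (induction j arbitrary: u)
    case (Suc j)
    have "diff_upto j a (D a (\<lambda>x. of_real (u x) :: 'a))"
      by (rule diff_upto_cong[OF _ Suc.IH[of "D a u"]])
         (use Suc.prems assms(1) in \<open>auto simp: D_of_real smooth_D\<close>)
    moreover have "(\<lambda>x. of_real (u x) :: 'a) differentiable (at x within {0..a})" if "x \<in> {0..a}" for x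
      using smooth_has_D[OF Suc.prems that] has_vector_derivative_of_real differentiableI_vector
      by (metis has_real_derivative_iff_has_vector_derivative)
    ultimately show ?case by simp
  qed auto
  then show ?thesis by (simp add: smooth_iff_diff_upto)
qed

lemma Dn_add:
  assumes "a > 0"
  shows "smooth a u \<Longrightarrow> smooth a v \<Longrightarrow> x \<in> {0..a} \<Longrightarrow> Dn a j (\<lambda>x. u x + v x) x = Dn a j u x + Dn a j v x"
proof (induction j arbitrary: u v)
  case (Suc j)
  have "Dn a (Suc j) (\<lambda>x. u x + v x) x = Dn a j (\<lambda>x. D a u x + D a v x) x"
    unfolding Dn_Suc
    by (rule Dn_cong)
       (use Suc.prems assms in \<open>auto intro!: D_eqI has_vector_derivative_add smooth_has_D\<close>)
  also have "\<dots> = Dn a (Suc j) u x + Dn a (Suc j) v x"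
    unfolding Dn_Suc using Suc by (simp add: smooth_D)
  finally show ?case .
qed auto

lemma Dn_cmult:
  fixes u :: "real \<Rightarrow> 'a::real_normed_algebra"
  assumes "a > 0"
  shows "smooth a u \<Longrightarrow> x \<in> {0..a} \<Longrightarrow> Dn a j (\<lambda>x. c * u x) x = c * Dn a j u x"
proof (induction j arbitrary: u)
  case (Suc j)
  have "Dn a (Suc j) (\<lambda>x. c * u x) x = Dn a j (\<lambda>x. c * D a u x) x"
    unfolding Dn_Suc
    by (rule Dn_cong)
       (use Suc.prems assms in \<open>auto intro!: D_eqI bounded_linear.has_vector_derivative[OF bounded_linear_mult_right] smooth_has_D\<close>)
  also have "\<dots> = c * Dn a (Suc j) u x"
    unfolding Dn_Suc using Suc by (simp add: smooth_D)
  finally show ?case .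
qed auto

lemma D_power_Suc_mult:
  fixes G v :: "real \<Rightarrow> 'a::real_normed_field"
  assumes "a > 0" "smooth a G" "smooth a v" "x \<in> {0..a}"
  shows "D a (\<lambda>x. G x ^ Suc k * v x) x = G x ^ k * (of_nat (Suc k) * D a G x * v x + G x * D a v x)"
proof -
  have "((\<lambda>x. G x ^ Suc k) has_vector_derivative of_nat (Suc k) * (D a G x * G x ^ k)) (at x within {0..a})"
  proof (induction k)
    case 0
    show ?case using smooth_has_D[OF assms(2,4)] by simp
  next
    case (Suc k)
    have "((\<lambda>x. G x * G x ^ Suc k) has_vector_derivative
        G x * (of_nat (Suc k) * (D a G x * G x ^ k)) + D a G x * G x ^ Suc k) (at x within {0..a})"
      by (rule has_vector_derivative_mult[OF smooth_has_D[OF assms(2,4)] Suc])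
    then show ?case by (simp add: algebra_simps)
  qed
  from has_vector_derivative_mult[OF this smooth_has_D[OF assms(3,4)]]
  have "D a (\<lambda>x. G x ^ Suc k * v x) x = G x ^ Suc k * D a v x + of_nat (Suc k) * (D a G x * G x ^ k) * v x"
    by (rule D_eqI[OF assms(1,4)])
  then show ?thesis by (simp add: algebra_simps)
qed

text \<open>
  A factor \<open>G\<^sup>k\<close> with \<open>G x = 0\<close> forces a zero of order \<open>k\<close>: each derivative up to order \<open>k\<close> lowers the
  exponent by one and turns the cofactor \<open>v\<close> into one that equals \<open>i G' v\<close> at \<open>x\<close>, where \<open>i\<close> is the
  exponent just lowered.
\<close>

lemma Dn_power_mult:
  fixes G v :: "real \<Rightarrow> 'a::real_normed_field"
  assumes "a > 0" "smooth a G" "x \<in> {0..a}" "G x = 0"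
  shows "smooth a v \<Longrightarrow> j \<le> k \<Longrightarrow>
    Dn a j (\<lambda>x. G x ^ k * v x) x = (if j = k then fact k * D a G x ^ k * v x else 0)"
proof (induction j arbitrary: k v)
  case 0
  then show ?case using assms by (auto simp: power_0_left)
next
  case (Suc j)
  then obtain k' where k: "k = Suc k'" "j \<le> k'" by (metis Suc_le_D Suc_le_mono)
  let ?v = "\<lambda>x. of_nat (Suc k') * D a G x * v x + G x * D a v x"
  have "Dn a (Suc j) (\<lambda>x. G x ^ k * v x) x = Dn a j (\<lambda>x. G x ^ k' * ?v x) x"
    unfolding Dn_Suc k(1)
    using assms Suc.prems by (intro Dn_cong D_power_Suc_mult)
  also have "\<dots> = (if j = k' then fact k' * D a G x ^ k' * ?v x else 0)"
    by (rule Suc.IH)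
       (use assms Suc.prems k in \<open>auto intro!: smooth_add smooth_mult smooth_const smooth_D simp del: of_nat_Suc\<close>)
  finally show ?case using k assms(4) by (simp add: algebra_simps)
qed

section \<open>Hermite interpolation by weighted polynomials in a function\<close>

text \<open>
  The weight \<open>g'\<close> gives the elements of the span of \<^const>\<open>Psi\<close>, the weight \<open>1\<close> those of the span of
  \<^const>\<open>Phi\<close>.
\<close>

definition weighted_poly :: "(real \<Rightarrow> complex) \<Rightarrow> (real \<Rightarrow> complex) \<Rightarrow> complex poly \<Rightarrow> real \<Rightarrow> complex" where
  "weighted_poly b z P = (\<lambda>x. b x * poly P (z x))"

lemma smooth_weighted_poly:
  "a > 0 \<Longrightarrow> smooth a b \<Longrightarrow> smooth a z \<Longrightarrow> smooth a (weighted_poly b z P)"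
  unfolding weighted_poly_def by (intro smooth_mult smooth_poly)

lemma Dn_weighted_poly_add_smult:
  assumes "a > 0" "smooth a b" "smooth a z" "x \<in> {0..a}"
  shows "Dn a j (weighted_poly b z (P + smult c Q)) x
    = Dn a j (weighted_poly b z P) x + c * Dn a j (weighted_poly b z Q) x"
proof -
  have "weighted_poly b z (P + smult c Q) = (\<lambda>x. weighted_poly b z P x + c * weighted_poly b z Q x)"
    by (simp add: weighted_poly_def fun_eq_iff algebra_simps)
  with assms show ?thesis
    by (simp add: Dn_add Dn_cmult smooth_weighted_poly smooth_mult smooth_const)
qed

text \<open>
  Orders of vanishing of \<open>P\<close> at \<open>z x\<close> and of \<open>b \<cdot> P(z)\<close> at \<open>x\<close> agree when \<open>b x\<close> and \<open>z' x\<close> are nonzero;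
  this is the only link between polynomials and derivatives in the Hermite problem.
\<close>

lemma Dn_weighted_poly_root:
  assumes "a > 0" "smooth a b" "smooth a z" "x \<in> {0..a}" "j \<le> k"
  shows "Dn a j (weighted_poly b z ([:- z x, 1:] ^ k * R)) x
    = (if j = k then fact k * D a z x ^ k * (b x * poly R (z x)) else 0)"
proof -
  let ?G = "\<lambda>y. z y + (- z x)"
  have "smooth a ?G" using assms by (intro smooth_add smooth_const)
  moreover have "D a ?G x = D a z x"
    using has_vector_derivative_add[OF smooth_has_D[OF assms(3,4)] has_vector_derivative_const[of "- z x"]]
    by (intro D_eqI assms) simp_all
  moreover have "weighted_poly b z ([:- z x, 1:] ^ k * R) = (\<lambda>y. ?G y ^ k * weighted_poly b z R y)"
    by (simp add: weighted_poly_def fun_eq_iff algebra_simps)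
  ultimately show ?thesis
    using Dn_power_mult[OF assms(1) _ assms(4) _ smooth_weighted_poly[OF assms(1,2,3)] assms(5), of ?G R]
    by (simp add: weighted_poly_def)
qed

text \<open>
  A nonzero solution of the homogeneous problem would have at least \<open>\<Sum> m l\<close> roots, counted
  with multiplicity, at the points \<open>z (X l)\<close>.
\<close>

lemma hermite_unique:
  fixes X :: "'i \<Rightarrow> real"
  assumes "a > 0" "smooth a b" "smooth a z" "finite I" "X ` I \<subseteq> {0..a}"
    and "\<And>l. l \<in> I \<Longrightarrow> b (X l) \<noteq> 0" "\<And>l. l \<in> I \<Longrightarrow> D a z (X l) \<noteq> 0"
    and inj: "inj_on (\<lambda>l. z (X l)) I"
    and deg: "degree P < (\<Sum>l\<in>I. m l)"
    and zero: "\<And>l j. l \<in> I \<Longrightarrow> j < m l \<Longrightarrow> Dn a j (weighted_poly b z P) (X l) = 0"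
  shows "P = 0"
proof (rule ccontr)
  assume P: "P \<noteq> 0"
  have "m l \<le> order (z (X l)) P" if l: "l \<in> I" for l
  proof (rule ccontr)
    assume "\<not> ?thesis"
    then have less: "order (z (X l)) P < m l" by simp
    obtain R where R: "P = [:- z (X l), 1:] ^ order (z (X l)) P * R" "\<not> [:- z (X l), 1:] dvd R"
      using order_decomp[OF P] by blast
    have "Dn a (order (z (X l)) P) (weighted_poly b z P) (X l) \<noteq> 0"
      using assms l R(2) by (subst R(1), subst Dn_weighted_poly_root) (auto simp: poly_eq_0_iff_dvd)
    with zero[OF l less] show False by simp
  qed
  then have "(\<Sum>l\<in>I. m l) \<le> (\<Sum>l\<in>I. order (z (X l)) P)"
    by (rule sum_mono)
  also have "\<dots> = (\<Sum>y\<in>(\<lambda>l. z (X l)) ` I. order y P)"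
    by (simp add: sum.reindex[OF inj])
  also have "\<dots> = (\<Sum>y\<in>(\<lambda>l. z (X l)) ` I \<inter> {y. poly P y = 0}. order y P)"
    using assms(4) by (intro sum.mono_neutral_right) (auto simp: order_root P)
  also have "\<dots> \<le> (\<Sum>y | poly P y = 0. order y P)"
    using poly_roots_finite[OF P] by (intro sum_mono2) auto
  also have "\<dots> \<le> degree P"
    by (rule sum_order_le_degree[OF P])
  finally show False using deg by simp
qed

text \<open>
  Newton's scheme: the conditions are imposed one at a time. The nodal polynomial \<open>N\<close> of the
  conditions met so far does not disturb them, and the functional of the next condition is
  nonzero on \<open>N\<close>, so a multiple of \<open>N\<close> corrects it. The degree is bounded through the coefficients
  because the induction starts with no conditions at all, where \<open>P\<close> has to be \<open>0\<close>.
\<close>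

lemma hermite_exists:
  fixes X :: "'i \<Rightarrow> real"
  assumes "a > 0" "smooth a b" "smooth a z" "finite I" "X ` I \<subseteq> {0..a}"
    and "\<And>l. l \<in> I \<Longrightarrow> b (X l) \<noteq> 0" "\<And>l. l \<in> I \<Longrightarrow> D a z (X l) \<noteq> 0"
    and inj: "inj_on (\<lambda>l. z (X l)) I"
  shows "\<exists>P. (\<forall>k\<ge>(\<Sum>l\<in>I. m l). coeff P k = 0)
    \<and> (\<forall>l\<in>I. \<forall>j<m l. Dn a j (weighted_poly b z P) (X l) = Y l j)"
proof (induction "\<Sum>l\<in>I. m l" arbitrary: m)
  case 0
  then show ?case using assms(4) by (intro exI[of _ 0]) simp
next
  case (Suc s)
  then have "\<exists>l\<in>I. m l \<noteq> 0" by (metis sum.neutral nat.simps(3))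
  then obtain l0 where l0: "l0 \<in> I" "m l0 \<noteq> 0" by blast
  \<comment> \<open>The condition to be added is the highest derivative required at \<open>X l0\<close>.\<close>
  define m' where "m' = m(l0 := m l0 - 1)"
  have m: "m l0 = Suc (m' l0)" "\<And>l. l \<noteq> l0 \<Longrightarrow> m l = m' l"
    using l0 by (simp_all add: m'_def)
  have "(\<Sum>l\<in>I. m l) = Suc (\<Sum>l\<in>I. m' l)"
    using l0 m by (simp add: sum.remove[OF assms(4) l0(1)])
  with Suc.hyps have s: "s = (\<Sum>l\<in>I. m' l)" by simp
  obtain P where P: "\<And>k. k \<ge> s \<Longrightarrow> coeff P k = 0"
      "\<And>l j. l \<in> I \<Longrightarrow> j < m' l \<Longrightarrow> Dn a j (weighted_poly b z P) (X l) = Y l j"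
    using Suc.hyps(1)[OF s] s by auto
  define N where "N = (\<Prod>l\<in>I. [:- z (X l), 1:] ^ m' l)"
  define R where "R l = (\<Prod>l\<in>I - {l}. [:- z (X l), 1:] ^ m' l)" for l
  have N: "N = [:- z (X l), 1:] ^ m' l * R l" if "l \<in> I" for l
    unfolding N_def R_def using that assms(4) by (rule prod.remove[rotated])
  have degN: "degree N = s"
    unfolding N_def s by (subst degree_prod_eq_sum_degree) (auto simp: degree_power_eq)
  have XI: "X l \<in> {0..a}" if "l \<in> I" for l using assms(5) that by blast
  have N_zero: "Dn a j (weighted_poly b z N) (X l) = 0" if "l \<in> I" "j < m' l" for l j
    using that N[OF that(1)] Dn_weighted_poly_root[OF assms(1-3) XI[OF that(1)], of j "m' l" "R l"] by simp
  have "poly (R l0) (z (X l0)) \<noteq> 0"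
    using inj l0(1) assms(4) by (auto simp: R_def poly_prod inj_on_def)
  then have N_nz: "Dn a (m' l0) (weighted_poly b z N) (X l0) \<noteq> 0" (is "?d \<noteq> 0")
    using N[OF l0(1)] Dn_weighted_poly_root[OF assms(1-3) XI[OF l0(1)], of "m' l0" "m' l0" "R l0"]
      assms(6,7)[OF l0(1)] by simp
  define c where "c = (Y l0 (m' l0) - Dn a (m' l0) (weighted_poly b z P) (X l0)) / ?d"
  have "Dn a j (weighted_poly b z (P + smult c N)) (X l) = Y l j" if lj: "l \<in> I" "j < m l" for l j
  proof -
    consider "j < m' l" | "l = l0" "j = m' l0" using lj m by (cases "l = l0") (auto simp: less_Suc_eq)
    then show ?thesis
      using lj(1) N_zero P(2) N_nz
      by cases (simp_all add: Dn_weighted_poly_add_smult[OF assms(1-3) XI] c_def)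
  qed
  moreover have "coeff (P + smult c N) k = 0" if "k \<ge> Suc s" for k
    using that P(1) degN by (simp add: coeff_eq_0)
  ultimately show ?case using Suc.hyps(2) by metis
qed

lemma hermite_ex1:
  fixes X :: "'i \<Rightarrow> real"
  assumes "a > 0" "smooth a b" "smooth a z" "finite I" "X ` I \<subseteq> {0..a}"
    and "\<And>l. l \<in> I \<Longrightarrow> b (X l) \<noteq> 0" "\<And>l. l \<in> I \<Longrightarrow> D a z (X l) \<noteq> 0"
    and inj: "inj_on (\<lambda>l. z (X l)) I"
    and K: "(\<Sum>l\<in>I. m l) = Suc K"
  shows "\<exists>!P. degree P \<le> K \<and> (\<forall>l\<in>I. \<forall>j<m l. Dn a j (weighted_poly b z P) (X l) = Y l j)"
proof (rule ex_ex1I)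
  obtain P where P: "\<forall>k\<ge>Suc K. coeff P k = 0"
      "\<forall>l\<in>I. \<forall>j<m l. Dn a j (weighted_poly b z P) (X l) = Y l j"
    using hermite_exists[OF assms(1-8), of m Y] K by auto
  from P(1) have "degree P \<le> K" by (intro degree_le) auto
  with P(2) show "\<exists>P. degree P \<le> K \<and> (\<forall>l\<in>I. \<forall>j<m l. Dn a j (weighted_poly b z P) (X l) = Y l j)"
    by blast
next
  fix P Q
  assume P: "degree P \<le> K \<and> (\<forall>l\<in>I. \<forall>j<m l. Dn a j (weighted_poly b z P) (X l) = Y l j)"
    and Q: "degree Q \<le> K \<and> (\<forall>l\<in>I. \<forall>j<m l. Dn a j (weighted_poly b z Q) (X l) = Y l j)"
  have "P + smult (-1) Q = 0"
  proof (rule hermite_unique[OF assms(1-8)])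
    show "degree (P + smult (-1) Q) < (\<Sum>l\<in>I. m l)"
      using P Q K by (simp add: degree_diff_le less_Suc_eq_le)
    show "Dn a j (weighted_poly b z (P + smult (-1) Q)) (X l) = 0" if "l \<in> I" "j < m l" for l j
      using that P Q assms(5)
      by (subst Dn_weighted_poly_add_smult[OF assms(1-3)]) auto
  qed
  then show "P = Q" by simp
qed

section \<open>Spans of powers as sets of polynomials\<close>

lemma cspan_weighted_powers:
  "cspan {(\<lambda>x. b x * z x ^ k) | k. k < Suc K} = {weighted_poly b z P | P. degree P \<le> K}"
    (is "cspan ?S = ?T")
proof -
  interpret V: vector_space "\<lambda>(c::complex) (u :: real \<Rightarrow> complex) x. c * u x"
    by (rule vector_space_fun)
  show ?thesis unfolding cspan_def
  proof (intro equalityI V.span_minimal)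
    show "?S \<subseteq> ?T"
    proof clarify
      fix k assume "k < Suc K"
      then show "\<exists>P. (\<lambda>x. b x * z x ^ k) = weighted_poly b z P \<and> degree P \<le> K"
        by (intro exI[of _ "monom 1 k"])
           (auto simp: weighted_poly_def poly_monom degree_monom_eq)
    qed
    show "V.subspace ?T"
      unfolding V.subspace_def
    proof (intro conjI ballI allI)
      show "0 \<in> ?T"
        by (intro CollectI exI[of _ 0]) (auto simp: weighted_poly_def)
      fix u v c assume u: "u \<in> ?T"
      then obtain P where P: "u = weighted_poly b z P" "degree P \<le> K" by auto
      then show "(\<lambda>x. c * u x) \<in> ?T"
        by (intro CollectI exI[of _ "smult c P"]) (auto simp: weighted_poly_def degree_smult_le[THEN le_trans])
      assume "v \<in> ?T"
      then obtain Q where Q: "v = weighted_poly b z Q" "degree Q \<le> K" by auto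
      then show "u + v \<in> ?T" using P
        by (intro CollectI exI[of _ "P + Q"])
           (auto simp: weighted_poly_def fun_eq_iff algebra_simps degree_add_le)
    qed
    show "?T \<subseteq> V.span ?S"
    proof clarify
      fix P :: "complex poly" assume "degree P \<le> K"
      then have "(\<Sum>k\<le>degree P. (\<lambda>x. coeff P k * (b x * z x ^ k))) \<in> V.span ?S"
        by (intro V.span_sum V.span_scale V.span_base) auto
      moreover have "(\<Sum>k\<le>d. (\<lambda>x. coeff P k * (b x * z x ^ k)))
          = (\<lambda>x. b x * (\<Sum>k\<le>d. coeff P k * z x ^ k))" for d
        by (induction d) (auto simp: fun_eq_iff algebra_simps)
      ultimately show "weighted_poly b z P \<in> V.span ?S"
        by (simp add: weighted_poly_def poly_altdef)
    qed
  qed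
qed

lemma filon_solution_iff:
  "filon_solution a \<alpha> g n X m (Psi a g (K + 1)) f p \<longleftrightarrow>
    (\<exists>P. p = weighted_poly (\<lambda>x. of_real (D a g x)) (\<lambda>x. of_real (g x)) P \<and> degree P \<le> K
      \<and> interpolates a n X m p (f1 a \<alpha> g f))"
proof -
  have "Psi a g (K + 1) = {(\<lambda>x. complex_of_real (D a g x) * complex_of_real (g x) ^ k) | k. k < Suc K}"
    by (simp add: Psi_def)
  then show ?thesis
    unfolding filon_solution_def by (auto simp: cspan_weighted_powers)
qed

lemma cspan_Phi:
  "cspan (Phi g (Suc K)) = {(\<lambda>x. poly Q (of_real (g x))) | Q. degree Q \<le> K}"
proof -
  have Phi: "Phi g (Suc K) = {(\<lambda>x. 1 * complex_of_real (g x) ^ k) | k. k < Suc K}"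
    by (simp add: Phi_def)
  show ?thesis
    unfolding Phi cspan_weighted_powers by (simp add: weighted_poly_def)
qed

section \<open>The Levin operator on polynomials\<close>

text \<open>
  With \<open>\<omega> = i w\<close> and \<open>\<beta> = 1 + \<alpha>\<close> this is the Levin operator in the variable \<open>y = g x\<close>, divided by \<open>g'\<close>.
\<close>

definition levin_poly :: "complex \<Rightarrow> complex \<Rightarrow> complex \<Rightarrow> complex poly \<Rightarrow> complex poly" where
  "levin_poly \<omega> \<beta> c Q = [:\<omega> * c:] + pCons 0 (pderiv Q) + [:\<beta>, \<omega>:] * Q"

lemma levin_poly_add: "levin_poly \<omega> \<beta> (c + d) (P + Q) = levin_poly \<omega> \<beta> c P + levin_poly \<omega> \<beta> d Q"
  by (simp add: levin_poly_def pderiv_add smult_add_right algebra_simps)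

lemma levin_poly_diff: "levin_poly \<omega> \<beta> (c - d) (P - Q) = levin_poly \<omega> \<beta> c P - levin_poly \<omega> \<beta> d Q"
  by (simp add: levin_poly_def pderiv_diff smult_diff_right algebra_simps)

text \<open>
  The system for the coefficients of \<open>Q\<close> is triangular from the top down, with the constant
  diagonal entry \<open>\<omega>\<close>; this is why the operator is bijective as soon as \<open>\<omega> \<noteq> 0\<close>.
\<close>

lemma coeff_levin_poly_Suc:
  "coeff (levin_poly \<omega> \<beta> c Q) (Suc k) = (of_nat (Suc k) + \<beta>) * coeff Q (Suc k) + \<omega> * coeff Q k"
  by (simp add: levin_poly_def coeff_pderiv algebra_simps)

lemma degree_levin_poly_le:
  assumes "degree Q \<le> K" shows "degree (levin_poly \<omega> \<beta> c Q) \<le> Suc K"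
proof (rule degree_le, intro allI impI)
  fix i assume "Suc K < i"
  then obtain k where "i = Suc k" "K < k" by (cases i) auto
  then show "coeff (levin_poly \<omega> \<beta> c Q) i = 0"
    using assms by (simp add: coeff_levin_poly_Suc coeff_eq_0)
qed

lemma levin_poly_eq_0:
  assumes "\<omega> \<noteq> 0" "levin_poly \<omega> \<beta> c Q = 0"
  shows "c = 0 \<and> Q = 0"
proof -
  have "Q = 0"
  proof (rule ccontr)
    assume "Q \<noteq> 0"
    have "coeff (levin_poly \<omega> \<beta> c Q) (Suc (degree Q)) = \<omega> * lead_coeff Q"
      by (simp only: coeff_levin_poly_Suc) (simp add: coeff_eq_0)
    with assms \<open>Q \<noteq> 0\<close> show False by simp
  qed
  then show ?thesis using assms by (simp add: levin_poly_def)
qed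

lemma levin_poly_exists:
  assumes "\<omega> \<noteq> 0" "degree P \<le> Suc K"
  shows "\<exists>c Q. degree Q \<le> K \<and> levin_poly \<omega> \<beta> c Q = P"
  using assms(2)
proof (induction K arbitrary: P)
  case 0
  define q where "q = coeff P 1 / \<omega>"
  have "P = [:coeff P 0, coeff P 1:]"
    using 0 by (auto simp: poly_eq_iff coeff_pCons coeff_eq_0 split: nat.splits)
  also have "\<dots> = levin_poly \<omega> \<beta> ((coeff P 0 - \<beta> * q) / \<omega>) [:q:]"
    using assms(1) by (simp add: levin_poly_def q_def)
  finally show ?case by (metis degree_pCons_0 order_refl)
next
  case (Suc K)
  \<comment> \<open>The leading coefficient of \<open>Q\<close> is forced by that of \<open>P\<close>; removing its contribution lowers the degree.\<close>
  define q where "q = coeff P (Suc (Suc K)) / \<omega>"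
  let ?T = "levin_poly \<omega> \<beta> 0 (monom q (Suc K))"
  have "degree (P - ?T) \<le> Suc K"
  proof (rule degree_le, intro allI impI)
    fix i assume i: "Suc K < i"
    show "coeff (P - ?T) i = 0"
    proof (cases "i = Suc (Suc K)")
      case True
      then show ?thesis using assms(1)
        by (simp del: of_nat_Suc add: coeff_levin_poly_Suc q_def)
    next
      case False
      moreover have "degree ?T \<le> Suc (Suc K)"
        by (intro degree_levin_poly_le degree_monom_le)
      ultimately show ?thesis using i Suc.prems by (simp add: coeff_eq_0)
    qed
  qed
  then obtain c Q where Q: "degree Q \<le> K" "levin_poly \<omega> \<beta> c Q = P - ?T"
    using Suc.IH by blast
  then have "levin_poly \<omega> \<beta> c (Q + monom q (Suc K)) = P"
    using levin_poly_add[of \<omega> \<beta> c 0 Q "monom q (Suc K)"] by simp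
  moreover have "degree (Q + monom q (Suc K)) \<le> Suc K"
    using Q(1) by (intro degree_add_le degree_monom_le) simp
  ultimately show ?case by blast
qed

lemma levin_poly_inject:
  assumes "\<omega> \<noteq> 0" "levin_poly \<omega> \<beta> c P = levin_poly \<omega> \<beta> d Q"
  shows "c = d \<and> P = Q"
  using levin_poly_eq_0[OF assms(1), of \<beta> "c - d" "P - Q"] assms(2)
  by (simp add: levin_poly_diff)

lemma levin_W_poly:
  assumes "a > 0" "smooth a g" "x \<in> {0..a}"
  shows "levin_W a w \<alpha> g c (\<lambda>x. poly Q (of_real (g x))) x =
    weighted_poly (\<lambda>x. of_real (D a g x)) (\<lambda>x. of_real (g x)) (levin_poly (\<i> * w) (1 + complex_of_real \<alpha>) c Q) x"
proof -
  have "((\<lambda>x. complex_of_real (g x)) has_vector_derivative of_real (D a g x)) (at x within {0..a})"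
    using smooth_has_D[OF assms(2,3)]
    by (intro has_vector_derivative_of_real) (simp add: has_real_derivative_iff_has_vector_derivative)
  from field_vector_diff_chain_within[OF this DERIV_subset[OF poly_DERIV]]
  have "D a (\<lambda>x. poly Q (of_real (g x))) x = of_real (D a g x) * poly (pderiv Q) (of_real (g x))"
    by (intro D_eqI assms) (simp add: o_def)
  then show ?thesis
    by (simp add: levin_W_def weighted_poly_def levin_poly_def algebra_simps)
qed

section \<open>The Levin expression as an antiderivative\<close>

lemma strict_mono_on_if_D_pos:
  fixes g :: "real \<Rightarrow> real"
  assumes "a > 0" "smooth a g" "\<And>x. x \<in> {0..a} \<Longrightarrow> D a g x > 0"
  shows "strict_mono_on {0..a} g"
proof (rule strict_mono_onI)
  fix x y assume xy: "x \<in> {0..a}" "y \<in> {0..a}" "x < y"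
  show "g x < g y"
  proof (rule DERIV_pos_imp_increasing_open[OF xy(3)])
    fix t assume t: "x < t" "t < y"
    then have "t \<in> {0..a}" "at t within {0..a} = at t" using xy by (auto intro: at_within_Icc_at)
    then show "\<exists>d. (g has_real_derivative d) (at t) \<and> 0 < d"
      using smooth_has_D[OF assms(2), of t] assms(3)[of t]
      by (auto simp: has_real_derivative_iff_has_vector_derivative)
  next
    have "g differentiable_on {0..a}"
      using smooth_differentiable[OF assms(2)] by (simp add: differentiable_on_def)
    then show "continuous_on {x..y} g"
      using xy by (meson differentiable_imp_continuous_on continuous_on_subset atLeastatMost_subset_iff atLeastAtMost_iff)
  qed
qed

lemma smooth_continuous_on: "smooth a u \<Longrightarrow> continuous_on {0..a} u"
  by (intro differentiable_imp_continuous_on) (simp add: differentiable_on_def smooth_differentiable del: atLeastAtMost_iff)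

lemma smooth_has_D_at:
  assumes "smooth a u" "0 < x" "x < a"
  shows "(u has_vector_derivative D a u x) (at x)"
  using smooth_has_D[OF assms(1), of x] at_within_Icc_at[OF assms(2,3)] assms by simp

lemma norm_exp_i_minus_1_le: "norm (exp (\<i> * of_real y) - 1) \<le> \<bar>y\<bar>"
  using dist_exp_i_1[of y] abs_sin_x_le_abs_x[of "y/2"] by simp

context
  fixes a w \<alpha> :: real and g :: "real \<Rightarrow> real"
  assumes a: "a > 0" and alpha: "\<bar>\<alpha>\<bar> < 1" and g: "smooth a g" "g 0 = 0"
    and g': "\<And>x. x \<in> {0..a} \<Longrightarrow> D a g x > 0"
begin

lemma phase_pos: "0 < x \<Longrightarrow> x \<le> a \<Longrightarrow> g x > 0"
  using strict_mono_onD[OF strict_mono_on_if_D_pos[OF a g(1) g'], of 0 x] g(2) a by simp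

lemma phase_nonneg: "x \<in> {0..a} \<Longrightarrow> g x \<ge> 0"
  using phase_pos[of x] g(2) by (cases "x = 0") auto

lemma continuous_on_phase_powr:
  assumes "\<beta> > 0"
  shows "continuous_on {0..a} (\<lambda>x. g x powr \<beta>)"
  using assms phase_nonneg smooth_continuous_on[OF g(1)]
  by (intro continuous_on_powr') (auto intro: continuous_intros)

lemma has_vector_derivative_phase_powr:
  assumes "0 < x" "x < a"
  shows "((\<lambda>x. g x powr \<beta>) has_vector_derivative \<beta> * g x powr (\<beta> - 1) * D a g x) (at x)"
proof -
  have "(g has_real_derivative D a g x) (at x)"
    using smooth_has_D_at[OF g(1) assms] by (simp add: has_real_derivative_iff_has_vector_derivative)
  from DERIV_fun_powr[OF this, of \<beta>] show ?thesis
    using phase_pos[of x] assms by (simp add: has_real_derivative_iff_has_vector_derivative)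
qed

text \<open>
  For negative \<open>\<alpha>\<close> this function is unbounded near \<open>0\<close>, but \<open>g\<^sup>\<alpha>\<^sup>+\<^sup>1 / (\<alpha> + 1)\<close> is an
  antiderivative that is continuous up to \<open>0\<close>. It serves as the integrable majorant for the
  integral in \<^const>\<open>levin_h\<close>.
\<close>

lemma D_phase_times_phase_powr_integrable: "(\<lambda>x. D a g x * g x powr \<alpha>) integrable_on {0..a}"
proof -
  have "((\<lambda>x. D a g x * g x powr \<alpha>) has_integral
      g a powr (\<alpha> + 1) / (\<alpha> + 1) - g 0 powr (\<alpha> + 1) / (\<alpha> + 1)) {0..a}"
  proof (rule fundamental_theorem_of_calculus_interior)
    show "continuous_on {0..a} (\<lambda>x. g x powr (\<alpha> + 1) / (\<alpha> + 1))"
      using alpha by (intro continuous_intros continuous_on_phase_powr) auto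
    show "((\<lambda>x. g x powr (\<alpha> + 1) / (\<alpha> + 1)) has_vector_derivative D a g x * g x powr \<alpha>) (at x)"
      if "x \<in> {0<..<a}" for x
      using has_vector_derivative_divide[OF has_vector_derivative_phase_powr[of x "\<alpha> + 1"], of "\<alpha> + 1"] that alpha
      by (simp add: mult_ac)
  qed (use a in auto)
  then show ?thesis by (rule has_integral_integrable)
qed

text \<open>
  At \<open>t = 0\<close> this is \<open>0 / 0 = 0\<close>, whatever the sign of \<open>\<alpha>\<close>.
\<close>

definition levin_integrand :: "real \<Rightarrow> complex" where
  "levin_integrand t = complex_of_real (D a g t) * (1 - exp (\<i> * w * g t)) / complex_of_real (g t powr (1 - \<alpha>))"

lemma levin_integrand_bound:
  assumes "t \<in> {0..a}"
  shows "norm (levin_integrand t) \<le> \<bar>w\<bar> * (D a g t * g t powr \<alpha>)"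
proof (cases "t = 0")
  case True
  then show ?thesis using g(2) by (simp add: levin_integrand_def)
next
  case False
  then have t: "g t > 0" "D a g t > 0" using assms phase_pos g' by auto
  have "norm (levin_integrand t) = D a g t * norm (exp (\<i> * of_real (w * g t)) - 1) / g t powr (1 - \<alpha>)"
    using t by (simp add: levin_integrand_def norm_mult norm_divide norm_minus_commute mult.assoc)
  also have "\<dots> \<le> D a g t * \<bar>w * g t\<bar> / g t powr (1 - \<alpha>)"
    using t by (intro divide_right_mono mult_left_mono norm_exp_i_minus_1_le) auto
  also have "\<dots> = \<bar>w\<bar> * (D a g t * g t powr \<alpha>)"
    using t by (simp add: abs_mult powr_diff field_simps)
  finally show ?thesis .
qed

lemma levin_integrand_continuous: "continuous_on {0<..a} levin_integrand"
proof -
  have *: "continuous_on {0<..a} u" if "smooth a u" for u :: "real \<Rightarrow> real"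
    using smooth_continuous_on[OF that] by (rule continuous_on_subset) auto
  show ?thesis
    unfolding levin_integrand_def
    using *[OF g(1)] *[OF smooth_D[OF g(1)]] phase_pos
    by (intro continuous_intros) (auto simp: less_le)
qed

lemma levin_integrand_integrable: "levin_integrand integrable_on {0..a}"
proof -
  have "levin_integrand integrable_on {0<..a}"
  proof (rule measurable_bounded_by_integrable_imp_integrable)
    show "levin_integrand \<in> borel_measurable (lebesgue_on {0<..a})"
      by (intro continuous_imp_measurable_on_sets_lebesgue levin_integrand_continuous) auto
    have "(\<lambda>t. \<bar>w\<bar> * (D a g t * g t powr \<alpha>)) integrable_on {0..a}"
      by (intro integrable_on_mult_right D_phase_times_phase_powr_integrable)
    then show "(\<lambda>t. \<bar>w\<bar> * (D a g t * g t powr \<alpha>)) integrable_on {0<..a}"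
      by (rule integrable_spike_set) (auto intro: negligible_subset[of "{0}"])
  qed (auto intro: levin_integrand_bound)
  then show ?thesis
    by (rule integrable_spike_set) (auto intro: negligible_subset[of "{0}"])
qed

text \<open>
  The factor \<open>e\<^sup>-\<^sup>i\<^sup>w\<^sup>g\<close> in \<^const>\<open>levin_h\<close> cancels against the outer exponential, so that only a plain
  indefinite integral remains to be differentiated.
\<close>

lemma levin_primitive_eq:
  fixes c :: complex
  shows "levin_primitive a w \<alpha> g c q x = complex_of_real (g x powr (\<alpha> + 1)) * q x * exp (\<i> * w * g x)
     + c * ((exp (\<i> * w * g x) - 1) * complex_of_real (g x powr \<alpha>))
     + \<alpha> * c * integral {0..x} levin_integrand"
proof -
  have "exp (- \<i> * w * g x) * exp (\<i> * w * g x) = 1"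
    by (simp flip: exp_add)
  then have cancel: "(A + c * (1 - exp (- \<i> * w * g x)) * B + C * exp (- \<i> * w * g x) * I) * exp (\<i> * w * g x)
      = A * exp (\<i> * w * g x) + c * ((exp (\<i> * w * g x) - 1) * B) + C * I" for A B C I :: complex
    by algebra
  show ?thesis
    unfolding levin_primitive_def levin_h_def levin_integrand_def[abs_def, symmetric]
    by (simp only: cancel)
qed

lemma has_vector_derivative_exp_phase:
  assumes "0 < x" "x < a"
  shows "((\<lambda>x. exp (\<i> * w * g x)) has_vector_derivative \<i> * w * D a g x * exp (\<i> * w * g x)) (at x)"
proof -
  have "((\<lambda>x. \<i> * w * g x) has_vector_derivative \<i> * w * D a g x) (at x)"
    using smooth_has_D_at[OF g(1) assms]
    by (intro bounded_linear.has_vector_derivative[OF bounded_linear_mult_right] has_vector_derivative_of_real)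
       (simp add: has_real_derivative_iff_has_vector_derivative)
  from field_vector_diff_chain_at[OF this DERIV_exp] show ?thesis
    by (simp add: o_def)
qed

text \<open>
  For negative \<open>\<alpha>\<close> the power \<open>g\<^sup>\<alpha>\<close> blows up at \<open>0\<close>; the zero of \<open>e\<^sup>i\<^sup>w\<^sup>g - 1\<close> compensates it and leaves
  the bound \<open>\<bar>w\<bar> g\<^sup>1\<^sup>+\<^sup>\<alpha>\<close>.
\<close>

lemma continuous_on_oscillating_factor:
  "continuous_on {0..a} (\<lambda>x. (exp (\<i> * w * g x) - 1) * complex_of_real (g x powr \<alpha>))"
    (is "continuous_on _ ?u")
proof (unfold continuous_on_eq_continuous_within, rule)
  fix x assume x: "x \<in> {0..a}"
  have gc: "continuous (at x within {0..a}) g"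
    using smooth_continuous_on[OF g(1)] x by (simp add: continuous_on_eq_continuous_within)
  show "continuous (at x within {0..a}) ?u"
  proof (cases "x = 0")
    case False
    then have "g x > 0" using x phase_pos by auto
    then show ?thesis using gc by (intro continuous_intros) auto
  next
    case True
    have bound: "norm (?u t) \<le> \<bar>w\<bar> * g t powr (1 + \<alpha>)" if "t \<in> {0..a}" for t
    proof -
      have "norm (?u t) \<le> \<bar>w * g t\<bar> * g t powr \<alpha>"
        using norm_exp_i_minus_1_le[of "w * g t"]
        by (auto simp: norm_mult mult.assoc intro!: mult_right_mono)
      then show ?thesis using phase_nonneg[OF that]
        by (cases "g t = 0") (auto simp: abs_mult powr_add)
    qed
    have "((\<lambda>t. \<bar>w\<bar> * g t powr (1 + \<alpha>)) \<longlongrightarrow> \<bar>w\<bar> * g 0 powr (1 + \<alpha>)) (at 0 within {0..a})"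
      using continuous_on_phase_powr[of "1 + \<alpha>"] alpha a
      by (intro tendsto_mult tendsto_const) (auto simp: continuous_on_def)
    then have "((\<lambda>t. \<bar>w\<bar> * g t powr (1 + \<alpha>)) \<longlongrightarrow> 0) (at 0 within {0..a})"
      using g(2) by simp
    then have "(?u \<longlongrightarrow> 0) (at 0 within {0..a})"
      by (rule Lim_null_comparison[rotated])
         (use bound in \<open>auto simp: eventually_at_filter\<close>)
    then show ?thesis using True g(2) by (simp add: continuous_within)
  qed
qed

lemma levin_primitive_continuous:
  assumes "continuous_on {0..a} q"
  shows "continuous_on {0..a} (levin_primitive a w \<alpha> g c q)"
proof -
  have "continuous_on {0..a} (\<lambda>x. complex_of_real (g x powr (\<alpha> + 1)))"
    using alpha by (intro continuous_intros continuous_on_phase_powr) auto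
  moreover have "continuous_on {0..a} (\<lambda>x. exp (\<i> * w * g x))"
    using smooth_continuous_on[OF g(1)] by (intro continuous_intros)
  ultimately show ?thesis
    unfolding levin_primitive_eq[abs_def] using assms
    by (intro continuous_on_add continuous_on_mult continuous_on_const
        continuous_on_oscillating_factor indefinite_integral_continuous_1 levin_integrand_integrable)
qed

lemma levin_primitive_0: "levin_primitive a w \<alpha> g c q 0 = 0"
  by (simp add: levin_primitive_eq g(2))

text \<open>
  Here \<open>(e\<^sup>i\<^sup>w\<^sup>g - 1) \<alpha> g\<^sup>\<alpha>\<^sup>-\<^sup>1 g'\<close>, from differentiating \<open>g\<^sup>\<alpha>\<close>, cancels against \<open>\<alpha>\<close> times
  the integrand of \<^const>\<open>levin_h\<close>.
\<close>

lemma levin_primitive_derivative: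
  assumes "smooth a q" "0 < x" "x < a"
  shows "(levin_primitive a w \<alpha> g c q has_vector_derivative
    levin_W a w \<alpha> g c q x * complex_of_real (g x powr \<alpha>) * exp (\<i> * w * g x)) (at x)"
proof -
  let ?E = "\<lambda>x. exp (\<i> * w * g x)"
  have gx: "g x > 0" using phase_pos assms by auto
  have powr_deriv: "((\<lambda>x. complex_of_real (g x powr \<beta>)) has_vector_derivative
      of_real (\<beta> * g x powr (\<beta> - 1) * D a g x)) (at x)" for \<beta>
    using has_vector_derivative_phase_powr[OF assms(2,3), of \<beta>]
    by (intro has_vector_derivative_of_real) (simp add: has_real_derivative_iff_has_vector_derivative)
  have "continuous_on {0<..<a} levin_integrand"
    using levin_integrand_continuous by (rule continuous_on_subset) auto
  then have "continuous (at x) levin_integrand"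
    using assms(2,3) by (simp add: continuous_on_eq_continuous_at)
  then have "((\<lambda>x. integral {0..x} levin_integrand) has_vector_derivative levin_integrand x) (at x)"
    using integral_has_vector_derivative_continuous_at[OF levin_integrand_integrable, of x "{}"]
      at_within_Icc_at[OF assms(2,3)] assms(2,3) by simp
  note deriv = has_vector_derivative_add[OF has_vector_derivative_add[OF
        has_vector_derivative_mult[OF has_vector_derivative_mult[OF powr_deriv[of "\<alpha> + 1"]
            smooth_has_D_at[OF assms]] has_vector_derivative_exp_phase[OF assms(2,3)]]
        bounded_linear.has_vector_derivative[OF bounded_linear_mult_right[of c]
          has_vector_derivative_mult[OF has_vector_derivative_diff[OF
            has_vector_derivative_exp_phase[OF assms(2,3)] has_vector_derivative_const[of 1]]
            powr_deriv[of \<alpha>]]]]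
      bounded_linear.has_vector_derivative[OF bounded_linear_mult_right[of "\<alpha> * c"] this]]
  show ?thesis
    unfolding levin_primitive_eq[abs_def]
    using deriv
  proof (rule has_vector_derivative_eq_rhs)
    have p: "g x powr (\<alpha> + 1) = g x * g x powr \<alpha>" "g x powr (\<alpha> - 1) = g x powr \<alpha> / g x"
      "g x powr (1 - \<alpha>) = g x / g x powr \<alpha>"
      using gx by (simp_all add: powr_add powr_diff)
    show "complex_of_real (g x powr (\<alpha> + 1)) * q x * (\<i> * w * D a g x * ?E x) +
      (complex_of_real (g x powr (\<alpha> + 1)) * D a q x +
       of_real ((\<alpha> + 1) * g x powr (\<alpha> + 1 - 1) * D a g x) * q x) * ?E x +
      c * ((?E x - 1) * of_real (\<alpha> * g x powr (\<alpha> - 1) * D a g x) +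
       (\<i> * w * D a g x * ?E x - 0) * of_real (g x powr \<alpha>)) +
      \<alpha> * c * levin_integrand x =
      levin_W a w \<alpha> g c q x * complex_of_real (g x powr \<alpha>) * ?E x"
      using gx unfolding levin_W_def levin_integrand_def p
      by (simp add: p field_simps)
  qed
qed

lemma levin_primitive_FTC:
  assumes "smooth a q"
  shows "((\<lambda>x. levin_W a w \<alpha> g c q x * complex_of_real (g x powr \<alpha>) * exp (\<i> * w * g x))
    has_integral levin_primitive a w \<alpha> g c q a - Lim (at_right 0) (levin_primitive a w \<alpha> g c q)) {0..a}"
proof -
  let ?F = "levin_primitive a w \<alpha> g c q"
  have cont: "continuous_on {0..a} ?F"
    by (intro levin_primitive_continuous smooth_continuous_on assms)
  then have "(?F \<longlongrightarrow> ?F 0) (at_right 0)"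
    using a by (auto simp: continuous_on_def dest!: bspec[of _ _ 0] simp: at_within_Icc_at_right)
  then have "Lim (at_right 0) ?F = ?F 0"
    by (intro tendsto_Lim) auto
  moreover have "((\<lambda>x. levin_W a w \<alpha> g c q x * complex_of_real (g x powr \<alpha>) * exp (\<i> * w * g x))
    has_integral ?F a - ?F 0) {0..a}"
    using a by (intro fundamental_theorem_of_calculus_interior cont levin_primitive_derivative assms) auto
  ultimately show ?thesis by simp
qed

end

section \<open>Equality of the two methods\<close>

lemma interpolates_cong:
  assumes "\<And>x. x \<in> {0..a} \<Longrightarrow> u x = v x" "\<And>l. l \<le> n \<Longrightarrow> X l \<in> {0..a}"
  shows "interpolates a n X m u y \<longleftrightarrow> interpolates a n X m v y"
proof -
  have "Dn a j u (X l) = Dn a j v (X l)" if "l \<le> n" for j l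
    by (rule Dn_cong[OF assms(1) assms(2)[OF that]])
  then show ?thesis by (simp add: interpolates_def)
qed

theorem theorem2p6:
  fixes a w \<alpha> :: real
    and f :: "real \<Rightarrow> complex"
    and g :: "real \<Rightarrow> real"
    and n M :: nat
    and X :: "nat \<Rightarrow> real"
    and m :: "nat \<Rightarrow> nat"
  assumes "a > 0"
    and "w \<noteq> 0"
    and "0 < \<bar>\<alpha>\<bar>" and "\<bar>\<alpha>\<bar> < 1"
    and "smooth a f" and "smooth a g"
    and "g 0 = 0"
    and "\<And>x. x \<in> {0..a} \<Longrightarrow> D a g x > 0"
    and "X 0 = 0" and "X n = a" and "\<And>i. i < n \<Longrightarrow> X i < X (Suc i)"
    and "\<And>l. l \<le> n \<Longrightarrow> m l \<ge> 1"
    and "M = (\<Sum>l\<le>n. m l) - 1"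
  shows "(\<exists>!p. filon_solution a \<alpha> g n X m (Psi a g (M + 1)) f p)
       \<and> (\<exists>!cq. levin_solution a w \<alpha> g n X m (Phi g M) f cq)
       \<and> Q_filon a w \<alpha> g n X m (Psi a g (M + 1)) f = Q_levin a w \<alpha> g n X m (Phi g M) f"
proof -
  note a = assms(1) and g = assms(6) and g' = assms(8)
  define b z where "b = (\<lambda>x. complex_of_real (D a g x))" and "z = (\<lambda>x. complex_of_real (g x))"
  have smooth: "smooth a b" "smooth a z"
    unfolding b_def z_def using a g by (auto intro: smooth_of_real smooth_D)

  have X_less: "X i < X j" if "i < j" "j \<le> n" for i j
    using that
  proof (induction j)
    case (Suc j)
    then show ?case using assms(11)[of j] by (cases "i = j") auto
  qed simp
  have X_mem: "X l \<in> {0..a}" if "l \<le> n" for l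
    using X_less[of 0 l] X_less[of l n] that assms(9,10) by (cases "l = 0"; cases "l = n") auto
  have inj: "inj_on (\<lambda>l. z (X l)) {..n}"
  proof (rule inj_onI)
    fix k l assume "k \<in> {..n}" "l \<in> {..n}" "z (X k) = z (X l)"
    then have "X k = X l"
      using strict_mono_on_imp_inj_on[OF strict_mono_on_if_D_pos[OF a g g']] X_mem
      by (auto simp: z_def dest: inj_onD)
    then show "k = l"
      using X_less[of k l] X_less[of l k] \<open>k \<in> {..n}\<close> \<open>l \<in> {..n}\<close> by (cases k l rule: linorder_cases) auto
  qed
  have nz: "b (X l) \<noteq> 0" "D a z (X l) \<noteq> 0" if "l \<in> {..n}" for l
    using g'[of "X l"] X_mem[of l] that D_of_real[OF a g, of "X l", where 'a = complex] by (auto simp: b_def z_def)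

  \<comment> \<open>There are at least two nodes, so \<open>M\<close> is positive and \<open>\<Phi>\<close> is a nonempty basis.\<close>
  have "n \<noteq> 0" using assms(1,9,10) by (intro notI) simp
  have "card {..n} \<le> (\<Sum>l\<le>n. m l)"
    using sum_mono[of "{..n}" "\<lambda>_. 1" m] assms(12) by simp
  then have sum_m: "(\<Sum>l\<le>n. m l) = Suc M" and "M \<noteq> 0"
    using assms(13) \<open>n \<noteq> 0\<close> by auto
  then obtain K where M: "M = Suc K" by (metis not0_implies_Suc)

  have "\<exists>!P. degree P \<le> M \<and> interpolates a n X m (weighted_poly b z P) (f1 a \<alpha> g f)"
    using hermite_ex1[OF a smooth finite_atMost _ nz inj sum_m, of "\<lambda>l j. Dn a j (f1 a \<alpha> g f) (X l)"] X_mem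
    unfolding interpolates_def by (simp add: image_subset_iff Ball_def)
  then obtain P where P: "degree P \<le> M" "interpolates a n X m (weighted_poly b z P) (f1 a \<alpha> g f)"
    and P_unique: "\<And>R. degree R \<le> M \<Longrightarrow> interpolates a n X m (weighted_poly b z R) (f1 a \<alpha> g f) \<Longrightarrow> R = P"
    by (elim ex1E) blast

  have filon: "filon_solution a \<alpha> g n X m (Psi a g (M + 1)) f p \<longleftrightarrow> p = weighted_poly b z P" for p
    unfolding filon_solution_iff b_def[symmetric] z_def[symmetric] using P P_unique by blast

  have w: "\<i> * complex_of_real w \<noteq> 0" using assms(2) by simp
  obtain c Q where Q: "degree Q \<le> K" "levin_poly (\<i> * w) (1 + complex_of_real \<alpha>) c Q = P"
    using levin_poly_exists[OF w] P(1) M by blast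
  define q where "q = (\<lambda>x. poly Q (z x))"

  have W: "levin_W a w \<alpha> g d (\<lambda>x. poly R (z x)) x = weighted_poly b z (levin_poly (\<i> * w) (1 + complex_of_real \<alpha>) d R) x"
    if "x \<in> {0..a}" for d R x
    unfolding z_def b_def by (rule levin_W_poly[OF a g that])
  have W_interp: "interpolates a n X m (levin_W a w \<alpha> g d (\<lambda>x. poly R (z x))) y
      \<longleftrightarrow> interpolates a n X m (weighted_poly b z (levin_poly (\<i> * w) (1 + complex_of_real \<alpha>) d R)) y" for d R y
    by (rule interpolates_cong[OF W X_mem])
  have levin: "levin_solution a w \<alpha> g n X m (Phi g M) f dr \<longleftrightarrow> dr = (c, q)" for dr
  proof
    assume "dr = (c, q)"
    then show "levin_solution a w \<alpha> g n X m (Phi g M) f dr"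
      using Q P by (auto simp: levin_solution_def M cspan_Phi q_def W_interp) (auto simp: z_def)
  next
    assume "levin_solution a w \<alpha> g n X m (Phi g M) f dr"
    then obtain d R where dr: "dr = (d, \<lambda>x. poly R (z x))" and R: "degree R \<le> K"
      "interpolates a n X m (levin_W a w \<alpha> g d (\<lambda>x. poly R (z x))) (f1 a \<alpha> g f)"
      by (auto simp: levin_solution_def M cspan_Phi z_def)
    have "levin_poly (\<i> * w) (1 + complex_of_real \<alpha>) d R = P"
      using R degree_levin_poly_le[OF R(1)] M by (intro P_unique) (auto simp: W_interp)
    with Q(2) have "d = c \<and> R = Q" by (intro levin_poly_inject[OF w, of "1 + complex_of_real \<alpha>"]) simp
    then show "dr = (c, q)" by (simp add: dr q_def)
  qed

  have "Q_filon a w \<alpha> g n X m (Psi a g (M + 1)) f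
      = integral {0..a} (\<lambda>x. weighted_poly b z P x * complex_of_real (g x powr \<alpha>) * exp (\<i> * w * g x))"
    unfolding Q_filon_def filon the_eq_trivial Let_def ..
  also have "\<dots> = integral {0..a} (\<lambda>x. levin_W a w \<alpha> g c q x * complex_of_real (g x powr \<alpha>) * exp (\<i> * w * g x))"
    by (rule integral_cong) (simp add: q_def W Q(2))
  also have "\<dots> = levin_primitive a w \<alpha> g c q a - Lim (at_right 0) (levin_primitive a w \<alpha> g c q)"
    unfolding q_def
    by (rule integral_unique[OF levin_primitive_FTC[OF a assms(4) g assms(7) g' smooth_poly[OF a smooth(2)]]])
  also have "\<dots> = Q_levin a w \<alpha> g n X m (Phi g M) f"
    unfolding Q_levin_def levin the_eq_trivial Let_def prod.case ..
  finally show ?thesis unfolding filon levin by blast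
qed

end
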